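(* Let $0\leq \alpha<1$. The Booth lemniscate starlikeness radius of order $\alpha$ for the class $\mathcal{K}$ of convex functions is $$R_{\mathcal{BS}(\alpha)}(\mathcal{K})=\begin{cases}\dfrac{1}{2-\alpha }, & 0\leq \alpha\leq \dfrac{1}{5},\\[3mm] \dfrac{2\sqrt{\alpha}}{(1+\alpha)\sqrt{ 1+4\alpha }}, & \dfrac{1}{5}\leq\alpha < 1.\end{cases}$$
   Context: $\mathbb{D}=\{z\in\mathbb{C}:|z|<1\}$. $\mathcal{A}$ is the class of analytic functions $f$ on $\mathbb{D}$ with $f(0)=0$, $f'(0)=1$. The expression $zf'(z)/f(z)$ takes the value $1$ at $z=0$; in conditions on it, it is understood to be analytic. For $0\le\alpha<1$, $G_\alpha(z)=1+\dfrac{z}{1-\alpha z^2}$ on $\mathbb{D}$. For a class $\mathcal{M}\subseteq\mathcal{A}$ and $f\in\mathcal{M}$ let $$R_f=\sup\left\{r\in(0,1): \frac{zf'(z)}{f(z)}\in G_\alpha(\mathbb{D})\text{ for all }|z|\le r\right\},\qquad R_{\mathcal{BS}(\alpha)}(\mathcal{M})=\inf\{R_f: f\in\mathcal{M}\}.$$ The number $R_{\mathcal{BS}(\alpha)}(\mathcal{M})$ is called the Booth lemniscate starlikeness radius of order $\alpha$ of $\mathcal{M}$. $\mathcal{S}^*$ is the class of starlike functions: the $f\in\mathcal{A}$ with $\operatorname{Re}\left(zf'(z)/f(z)\right)>0$ for all $z\in\mathbb{D}$; and $\mathcal{K}=\{f\in\mathcal{A}: zf'(z)\in\mathcal{S}^*\}$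 is the class of convex functions. *)

theory Defs
  imports "HOL-Complex_Analysis.Complex_Analysis"
begin

text \<open>The open unit disk is \<open>ball 0 1\<close>. Functions on it are represented by total functions
  \<open>complex \<Rightarrow> complex\<close>, whose values outside the disk play no role in any definition below.\<close>

definition normalized_analytic :: "(complex \<Rightarrow> complex) set" where
  "normalized_analytic = {f. f holomorphic_on ball 0 1 \<and> f 0 = 0 \<and> deriv f 0 = 1}"

text \<open>The quotient \<open>z f'(z) / f(z)\<close> with its removable singularity at \<open>0\<close> filled in. At a zero
  \<open>z \<noteq> 0\<close> of \<open>f\<close> it has a pole, but HOL division returns the junk value \<open>0\<close> there, which may lie
  in \<open>booth_map \<alpha> ` ball 0 1\<close>. Conditions on the quotient therefore state its analyticity
  explicitly.\<close>

definition starlike_quotient :: "(complex \<Rightarrow> complex) \<Rightarrow> complex \<Rightarrow> complex" where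
  "starlike_quotient f z = (if z = 0 then 1 else z * deriv f z / f z)"

definition starlike_class :: "(complex \<Rightarrow> complex) set" where
  "starlike_class = {f \<in> normalized_analytic.
     starlike_quotient f holomorphic_on ball 0 1 \<and>
     (\<forall>z \<in> ball 0 1. Re (starlike_quotient f z) > 0)}"

definition convex_class :: "(complex \<Rightarrow> complex) set" where
  "convex_class = {f \<in> normalized_analytic. (\<lambda>z. z * deriv f z) \<in> starlike_class}"

definition booth_map :: "real \<Rightarrow> complex \<Rightarrow> complex" where
  "booth_map \<alpha> z = 1 + z / (1 - of_real \<alpha> * z^2)"

definition booth_radius_fun :: "real \<Rightarrow> (complex \<Rightarrow> complex) \<Rightarrow> real" where
  "booth_radius_fun \<alpha> f = Sup {r \<in> {0<..<1}.
     starlike_quotient f analytic_on cball 0 r \<and>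
     (\<forall>z \<in> cball 0 r. starlike_quotient f z \<in> booth_map \<alpha> ` ball 0 1)}"

definition booth_starlikeness_radius :: "real \<Rightarrow> (complex \<Rightarrow> complex) set \<Rightarrow> real" where
  "booth_starlikeness_radius \<alpha> M = Inf (booth_radius_fun \<alpha> ` M)"

end

theory Submission
  imports Defs
begin

text \<open>For convex \<open>f\<close> put \<open>w = 1 - f / (z f')\<close>, so that
  \<open>1 + z f'' / f' = (1 + z w') / (1 - w)\<close>. If \<open>|w|\<close> first reached \<open>1\<close> at a point \<open>z0\<close>,
  Jack's lemma would give \<open>z0 w'(z0) = k w(z0)\<close> with \<open>k \<ge> 1\<close>, and the real part would be at most
  \<open>0\<close> there. Hence \<open>|w(z)| \<le> |z|\<close> and \<open>z f' / f = 1 / (1 - w)\<close>, with \<open>z / (1 - z)\<close> extremal.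
  In the coordinate \<open>1 / (p - 1)\<close> on values \<open>p\<close> of \<open>z f' / f\<close>, the Booth domain is the exterior of an ellipse, while the image of
  the disk of radius \<open>r\<close> under \<open>1 / (1 - \<zeta>)\<close> is the exterior of the circle of radius \<open>1 / r\<close> about
  \<open>-1\<close>; so \<open>1 / r\<close> has to exceed the largest distance from \<open>-1\<close> to the ellipse. The maximum is at
  the vertex \<open>1 - \<alpha>\<close> if \<open>\<alpha> \<le> 1/5\<close> and at an interior parameter otherwise.\<close>

section \<open>Jack's lemma\<close>

lemma has_real_derivative_norm_squared:
  fixes g :: "real \<Rightarrow> 'a :: real_inner"
  assumes "(g has_vector_derivative d) (at t)"
  shows "((\<lambda>t. (norm (g t))\<^sup>2) has_real_derivative 2 * (g t \<bullet> d)) (at t)"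
proof -
  have "(g has_derivative (\<lambda>h. h *\<^sub>R d)) (at t)"
    using assms by (simp add: has_vector_derivative_def)
  from has_derivative_inner[OF this this]
  have "((\<lambda>t. g t \<bullet> g t) has_derivative (\<lambda>h. 2 * (g t \<bullet> d) * h)) (at t)"
    by (simp add: inner_commute algebra_simps)
  then show ?thesis
    by (simp add: has_field_derivative_def power2_norm_eq_inner)
qed

text \<open>With \<open>F \<zeta> = w (z0 * \<zeta>) / w z0\<close>, the Schwarz lemma gives linear
  growth along the radius to \<open>z0\<close>, so the radial derivative of the squared modulus
  there is at least \<open>2 * ?M\<^sup>2\<close>. The tangential derivative vanishes because the
  modulus is maximal on the circle at \<open>z0\<close>. Together these make
  \<open>z0 * deriv w z0 * cnj (w z0)\<close> real and at least \<open>?M\<^sup>2\<close>.\<close>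

lemma Jack_lemma:
  assumes holo: "w holomorphic_on S" and "open S" and sub: "cball 0 (norm z0) \<subseteq> S"
    and w0: "w 0 = 0" and nz: "z0 \<noteq> 0"
    and strict: "\<And>z. norm z < norm z0 \<Longrightarrow> norm (w z) < norm (w z0)"
  obtains k :: real where "k \<ge> 1" and "z0 * deriv w z0 = of_real k * w z0"
proof -
  let ?M = "norm (w z0)" and ?u = "z0 * deriv w z0"
  have Mpos: "?M > 0" using strict[of 0] nz w0 by simp
  have z0S: "z0 \<in> S" using sub by auto
  have d0: "(w has_field_derivative deriv w z0) (at z0)"
    using holomorphic_derivI[OF holo \<open>open S\<close> z0S] .
  define F where "F = (\<lambda>\<zeta>. w (z0 * \<zeta>) / w z0)"
  have z0_mult: "norm (z0 * \<zeta>) < norm z0" if "norm \<zeta> < 1" for \<zeta>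
    using that nz by (simp add: norm_mult)
  have F_holo: "F holomorphic_on ball 0 1"
  proof -
    have "w \<circ> (*) z0 holomorphic_on ball 0 1"
      using z0_mult sub by (intro holomorphic_on_compose_gen[OF _ holo] holomorphic_intros) force
    then show ?thesis
      using Mpos unfolding F_def o_def by (intro holomorphic_intros) auto
  qed
  have F_lt: "norm (F \<zeta>) < 1" if "norm \<zeta> < 1" for \<zeta>
    using strict[OF z0_mult[OF that]] Mpos by (simp add: F_def norm_divide)
  have F_le: "norm (F \<zeta>) \<le> norm \<zeta>" if "norm \<zeta> < 1" for \<zeta>
    using Schwarz_Lemma(1)[OF F_holo _ F_lt that] by (simp add: F_def w0)
  have radial: "norm (w (z0 * of_real t)) \<le> t * ?M" if "0 \<le> t" "t < 1" for t
    using F_le[of "of_real t"] that Mpos by (simp add: F_def norm_divide field_simps)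
  have closed: "norm (w z) \<le> ?M" if "norm z = norm z0" for z
  proof (rule continuous_le_on_closure[where f = "\<lambda>z. norm (w z)" and S = "ball 0 (norm z0)" and a = "?M"])
    show "continuous_on (closure (ball 0 (norm z0))) (\<lambda>z. norm (w z))"
      using holo sub nz
      by (intro continuous_on_norm holomorphic_on_imp_continuous_on) (auto intro: holomorphic_on_subset)
    show "z \<in> closure (ball 0 (norm z0))" using that nz by simp
    show "\<And>x. x \<in> ball 0 (norm z0) \<Longrightarrow> norm (w x) \<le> ?M"
      using strict by (auto intro: less_imp_le)
  qed

  have "((\<lambda>t. w (z0 * of_real t)) has_vector_derivative z0 * 1 * deriv w (z0 * of_real 1)) (at 1)"
    by (rule field_vector_diff_chain_at[where g = w, unfolded o_def])
       (use d0 in \<open>auto intro!: derivative_eq_intros has_vector_derivative_real_field\<close>)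
  then have "((\<lambda>t. (norm (w (z0 * of_real t)))\<^sup>2) has_real_derivative 2 * (w z0 \<bullet> ?u)) (at 1)"
    using has_real_derivative_norm_squared by force
  moreover have "((\<lambda>t :: real. t\<^sup>2 * ?M\<^sup>2) has_real_derivative 2 * ?M\<^sup>2) (at 1)"
    by (auto intro!: derivative_eq_intros)
  ultimately have D1: "((\<lambda>t. t\<^sup>2 * ?M\<^sup>2 - (norm (w (z0 * of_real t)))\<^sup>2) has_real_derivative
      2 * ?M\<^sup>2 - 2 * (w z0 \<bullet> ?u)) (at 1)"
    by (intro DERIV_diff)
  have ge: "w z0 \<bullet> ?u \<ge> ?M\<^sup>2"
  proof (rule ccontr)
    assume "\<not> ?thesis"
    \<comment> \<open>The difference in \<open>D1\<close> vanishes at 1. A positive derivative would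
      make it negative just to the left of 1, against \<open>radial\<close>.\<close>
    then have "0 < 2 * ?M\<^sup>2 - 2 * (w z0 \<bullet> ?u)" by simp
    from DERIV_pos_inc_left[OF D1 this] obtain d where "d > 0" and
      d: "\<And>h. 0 < h \<Longrightarrow> h < d \<Longrightarrow>
        (1-h)\<^sup>2 * ?M\<^sup>2 - (norm (w (z0 * of_real (1-h))))\<^sup>2 < 0"
      by auto
    define h where "h = min (d/2) (1/2)"
    have h: "0 < h" "h < d" "h < 1" using \<open>d > 0\<close> by (auto simp: h_def)
    have "(norm (w (z0 * of_real (1-h))))\<^sup>2 \<le> ((1-h) * ?M)\<^sup>2"
      using radial[of "1-h"] h by (intro power_mono) auto
    with d[OF h(1,2)] show False by (simp add: power_mult_distrib)
  qed

  have "((\<lambda>t. w (z0 * exp (\<i> * of_real t))) has_vector_derivative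
      z0 * \<i> * deriv w (z0 * exp (\<i> * of_real 0))) (at 0)"
    by (rule field_vector_diff_chain_at[where g = w, unfolded o_def])
       (use d0 in \<open>auto intro!: derivative_eq_intros has_vector_derivative_real_field\<close>)
  then have D2: "((\<lambda>t. (norm (w (z0 * exp (\<i> * of_real t))))\<^sup>2) has_real_derivative
      2 * (w z0 \<bullet> (\<i> * ?u))) (at 0)"
    using has_real_derivative_norm_squared by (force simp: mult_ac)
  \<comment> \<open>The curve stays on the circle through \<open>z0\<close> for every parameter, so
    by \<open>closed\<close> the maximum at 0 is global and any radius, here 1, serves.\<close>
  have "2 * (w z0 \<bullet> (\<i> * ?u)) = 0"
    by (rule DERIV_local_max[OF D2, of 1]) (auto intro!: power_mono closed simp: norm_mult)
  then have Im0: "Im (?u * cnj (w z0)) = 0"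
    by (simp add: inner_complex_def algebra_simps)
  have Re0: "Re (?u * cnj (w z0)) = w z0 \<bullet> ?u"
    by (simp add: inner_complex_def algebra_simps)
  have "?u * cnj (w z0) = of_real (w z0 \<bullet> ?u)"
    using Im0 Re0 by (simp add: complex_eq_iff)
  then have "?u * (cnj (w z0) * w z0) = of_real (w z0 \<bullet> ?u) * w z0"
    by (simp only: mult.assoc[symmetric])
  moreover have "cnj (w z0) * w z0 = of_real (?M\<^sup>2)"
    by (metis complex_norm_square mult.commute of_real_power)
  ultimately have "?u * of_real (?M\<^sup>2) = of_real (w z0 \<bullet> ?u) * w z0"
    by (simp only:)
  then have "?u = of_real ((w z0 \<bullet> ?u) / ?M\<^sup>2) * w z0"
    using Mpos by (simp add: field_simps)
  moreover have "(w z0 \<bullet> ?u) / ?M\<^sup>2 \<ge> 1"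
    using ge Mpos by simp
  ultimately show ?thesis using that by blast
qed

section \<open>The Marx--Strohhaecker theorem\<close>

lemma convex_classD:
  assumes "f \<in> convex_class"
  shows "f holomorphic_on ball 0 1" "f 0 = 0" "deriv f 0 = 1"
    and "\<And>z. z \<in> ball 0 1 \<Longrightarrow> deriv f z \<noteq> 0"
    and "\<And>z. \<lbrakk>z \<in> ball 0 1; z \<noteq> 0\<rbrakk> \<Longrightarrow> Re (1 + z * deriv (deriv f) z / deriv f z) > 0"
proof -
  let ?g = "\<lambda>z. z * deriv f z"
  show holo: "f holomorphic_on ball 0 1" and "f 0 = 0" and d0: "deriv f 0 = 1"
    using assms by (auto simp: convex_class_def normalized_analytic_def)
  have pos: "Re (starlike_quotient ?g z) > 0" if "z \<in> ball 0 1" for z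
    using assms that by (auto simp: convex_class_def starlike_class_def)
  \<comment> \<open>At a zero of \<open>deriv f\<close> away from 0, division by zero would give the
    quotient of \<open>?g\<close> the value 0, which its positive real part forbids.\<close>
  show nz: "deriv f z \<noteq> 0" if "z \<in> ball 0 1" for z
    using pos[OF that] d0 by (cases "z = 0") (auto simp: starlike_quotient_def)
  show "Re (1 + z * deriv (deriv f) z / deriv f z) > 0" if z: "z \<in> ball 0 1" "z \<noteq> 0" for z
  proof -
    have "(deriv f has_field_derivative deriv (deriv f) z) (at z)"
      using holo z by (intro holomorphic_derivI[of _ "ball 0 1"] holomorphic_deriv) auto
    then have "(?g has_field_derivative (deriv f z + z * deriv (deriv f) z)) (at z)"
      by (auto intro!: derivative_eq_intros)
    then have "deriv ?g z = deriv f z + z * deriv (deriv f) z"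
      by (rule DERIV_imp_deriv)
    then have "starlike_quotient ?g z = 1 + z * deriv (deriv f) z / deriv f z"
      using z nz[OF z(1)] by (simp add: starlike_quotient_def field_simps)
    then show ?thesis using pos[OF z(1)] by simp
  qed
qed

text \<open>Dividing by \<open>z * deriv f z\<close> rather than by \<open>f z\<close> gives a function that is holomorphic
  before anything is known about the zeros of \<open>f\<close>.\<close>

lemma convex_class_schwarz_function:
  assumes "f \<in> convex_class"
  obtains w where "w holomorphic_on ball 0 1"
    and "\<And>z. z \<in> ball 0 1 \<Longrightarrow> f z = z * deriv f z * (1 - w z)"
    and "\<And>z. z \<in> ball 0 1 \<Longrightarrow> norm (w z) \<le> norm z"
proof -
  note f = convex_classD[OF assms]
  define g where "g = (\<lambda>z. if z = 0 then deriv f 0 else f z / z)"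
  have g_holo: "g holomorphic_on ball 0 1"
    using pole_theorem_open_0[OF f(1), of 0 g] f(2) by (auto simp: g_def)
  define w where "w = (\<lambda>z. 1 - g z / deriv f z)"
  have w_holo: "w holomorphic_on ball 0 1"
    unfolding w_def using f(1,4) g_holo by (intro holomorphic_intros) auto
  have w0: "w 0 = 0" by (simp add: w_def g_def f(3))
  have w_eq: "f z = z * deriv f z * (1 - w z)" if "z \<in> ball 0 1" for z
    using f(4)[OF that] f(2) by (auto simp: w_def g_def)
  \<comment> \<open>Obtained by differentiating \<open>w_eq\<close> and dividing by
    \<open>deriv f z\<close>.\<close>
  have w_deriv: "1 = (1 + z * deriv (deriv f) z / deriv f z) * (1 - w z) - z * deriv w z"
    if z: "z \<in> ball 0 1" for z
  proof -
    have d: "(deriv f has_field_derivative deriv (deriv f) z) (at z)"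
      "(w has_field_derivative deriv w z) (at z)"
      using f(1) w_holo z by (auto intro!: holomorphic_derivI[of _ "ball 0 1"] holomorphic_deriv)
    have "((\<lambda>z. z * deriv f z * (1 - w z)) has_field_derivative
        (deriv f z + z * deriv (deriv f) z) * (1 - w z) - z * deriv f z * deriv w z) (at z)"
      by (rule derivative_eq_intros d refl)+ (simp add: algebra_simps)
    moreover have "((\<lambda>z. z * deriv f z * (1 - w z)) has_field_derivative deriv f z) (at z)"
      by (rule has_field_derivative_transform_within_open[OF holomorphic_derivI[OF f(1) _ z] open_ball z])
         (use w_eq in auto)
    ultimately have "deriv f z =
        (deriv f z + z * deriv (deriv f) z) * (1 - w z) - z * deriv f z * deriv w z"
      using DERIV_unique by blast
    then show ?thesis using f(4)[OF z] by (simp add: field_simps)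
  qed
  have w_lt: "norm (w z) < 1" if "norm z < 1" for z
  proof (rule ccontr)
    assume z_ge: "\<not> norm (w z) < 1"
    \<comment> \<open>A point of least modulus in this compact set is a first point where the
      modulus of \<open>w\<close> reaches 1: below it the modulus is less than 1, and continuity
      forces equality there.\<close>
    define K where "K = cball 0 (norm z) \<inter> (\<lambda>x. norm (w x)) -` {1..}"
    have cont: "continuous_on (cball 0 (norm z)) w"
      using w_holo that by (auto intro!: holomorphic_on_imp_continuous_on elim: holomorphic_on_subset)
    have "closed K"
      unfolding K_def by (intro continuous_closed_preimage continuous_on_norm cont) auto
    then have "compact K"
      unfolding K_def compact_eq_bounded_closed by (auto intro: bounded_subset[OF bounded_cball])
    moreover have "z \<in> K" using z_ge by (auto simp: K_def)
    ultimately obtain z0 where z0: "z0 \<in> K" and min: "\<And>y. y \<in> K \<Longrightarrow> norm z0 \<le> norm y"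
      using continuous_attains_inf[of K norm] continuous_on_norm_id by blast
    have "norm z0 \<le> norm z" using z0 by (auto simp: K_def)
    have "norm z0 < 1" using z0 that by (auto simp: K_def)
    have "z0 \<noteq> 0" using z0 w0 by (auto simp: K_def)
    have less: "norm (w y) < 1" if "norm y < norm z0" for y
      using min[of y] that \<open>norm z0 \<le> norm z\<close> by (force simp: K_def)
    have ge1: "norm (w z0) \<ge> 1" using z0 by (simp add: K_def)
    have le1: "norm (w z0) \<le> 1"
    proof (rule continuous_le_on_closure[where f = "\<lambda>z. norm (w z)" and S = "ball 0 (norm z0)"])
      show "continuous_on (closure (ball 0 (norm z0))) (\<lambda>z. norm (w z))"
        using \<open>z0 \<noteq> 0\<close> \<open>norm z0 \<le> norm z\<close>
        by (intro continuous_on_norm continuous_on_subset[OF cont]) auto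
      show "z0 \<in> closure (ball 0 (norm z0))" using \<open>z0 \<noteq> 0\<close> by simp
    qed (use less in \<open>auto intro: less_imp_le\<close>)
    have "cball 0 (norm z0) \<subseteq> ball 0 1"
      using \<open>norm z0 < 1\<close> by auto
    moreover have "norm (w y) < norm (w z0)" if "norm y < norm z0" for y
      using less[OF that] ge1 by linarith
    ultimately obtain k :: real where k: "k \<ge> 1" "z0 * deriv w z0 = of_real k * w z0"
      using Jack_lemma[OF w_holo open_ball _ w0 \<open>z0 \<noteq> 0\<close>] by blast
    define q where "q = 1 + z0 * deriv (deriv f) z0 / deriv f z0"
    have q: "Re q > 0" using f(5)[of z0] \<open>norm z0 < 1\<close> \<open>z0 \<noteq> 0\<close> by (simp add: q_def)
    have eq: "1 + of_real k * w z0 = q * (1 - w z0)"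
      using w_deriv[of z0] \<open>norm z0 < 1\<close> k(2) by (simp add: q_def algebra_simps)
    have nw: "(Re (w z0))\<^sup>2 + (Im (w z0))\<^sup>2 = 1"
      using ge1 le1 by (metis cmod_power2 order_antisym power_one)
    have "w z0 \<noteq> 1" using eq k(1) by (auto simp: complex_eq_iff)
    then have "(norm (1 - w z0))\<^sup>2 > 0" by simp
    \<comment> \<open>Multiplying by the squared modulus of \<open>1 - w z0\<close> replaces the
      quotient for \<open>q\<close> by a polynomial; since \<open>w z0\<close> has modulus 1, it
      collapses to \<open>(1 - k) * (1 - Re (w z0))\<close>.\<close>
    then have "Re q * (norm (1 - w z0))\<^sup>2 > 0" using q by simp
    also have "Re q * (norm (1 - w z0))\<^sup>2 = Re (q * (1 - w z0) * cnj (1 - w z0))"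
      unfolding cmod_power2 by (simp add: power2_eq_square algebra_simps)
    also have "\<dots> = Re ((1 + of_real k * w z0) * cnj (1 - w z0))" by (simp only: eq)
    also have "\<dots> = 1 - Re (w z0) + k * Re (w z0) - k * ((Re (w z0))\<^sup>2 + (Im (w z0))\<^sup>2)"
      by (simp add: power2_eq_square algebra_simps)
    also have "\<dots> = (1 - k) * (1 - Re (w z0))" by (simp only: nw) algebra
    also have "\<dots> \<le> 0"
      using k(1) complex_Re_le_cmod[of "w z0"] le1 by (intro mult_nonpos_nonneg) auto
    finally show False by simp
  qed
  show thesis
    using that[OF w_holo w_eq] Schwarz_Lemma(1)[OF w_holo w0 w_lt] by simp
qed

lemma convex_class_starlike_quotient:
  assumes "f \<in> convex_class"
  obtains w where "\<And>z. z \<in> ball 0 1 \<Longrightarrow> norm (w z) \<le> norm z"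
    and "\<And>z. z \<in> ball 0 1 \<Longrightarrow> starlike_quotient f z = 1 / (1 - w z)"
    and "starlike_quotient f holomorphic_on ball 0 1"
proof -
  note f = convex_classD[OF assms]
  obtain w where w: "w holomorphic_on ball 0 1"
    "\<And>z. z \<in> ball 0 1 \<Longrightarrow> f z = z * deriv f z * (1 - w z)"
    "\<And>z. z \<in> ball 0 1 \<Longrightarrow> norm (w z) \<le> norm z"
    using convex_class_schwarz_function[OF assms] by blast
  have ne: "w z \<noteq> 1" if "z \<in> ball 0 1" for z
    using w(3)[OF that] that by auto
  have eq: "starlike_quotient f z = 1 / (1 - w z)" if "z \<in> ball 0 1" for z
    \<comment> \<open>At the origin the bound on \<open>w\<close> forces \<open>w 0 = 0\<close>,
      which matches the value 1 filled in there.\<close>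
    using w(2,3)[OF that] f(4)[OF that] ne[OF that] by (auto simp: starlike_quotient_def)
  have "(\<lambda>z. 1 / (1 - w z)) holomorphic_on ball 0 1"
    using w(1) ne by (intro holomorphic_intros) auto
  then have "starlike_quotient f holomorphic_on ball 0 1"
    using eq by (subst holomorphic_cong[OF refl]) auto
  with that w(3) eq show thesis by blast
qed

section \<open>The extremal function\<close>

lemma half_plane_map_convex_class: "(\<lambda>z. z / (1 - z)) \<in> convex_class"
  and starlike_quotient_half_plane_map:
    "z \<in> ball 0 1 \<Longrightarrow> starlike_quotient (\<lambda>z. z / (1 - z)) z = 1 / (1 - z)"
proof -
  let ?f = "\<lambda>z :: complex. z / (1 - z)"
  have ne: "1 - z \<noteq> 0" if "z \<in> ball 0 1" for z :: complex using that by auto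
  have d1: "deriv ?f z = 1 / (1 - z)\<^sup>2" if "z \<in> ball 0 1" for z
    by (rule DERIV_imp_deriv, (rule derivative_eq_intros refl)+)
       (use ne[OF that] in \<open>auto simp: field_simps power2_eq_square\<close>)
  have d2: "deriv (\<lambda>z. z * deriv ?f z) z = (1 + z) / (1 - z)^3" if z: "z \<in> ball 0 1" for z
  proof (rule DERIV_imp_deriv)
    have "((\<lambda>z. z * (1 / (1 - z)\<^sup>2)) has_field_derivative
        (1 * (1 - z)\<^sup>2 + 2 * (1 - z) * z) / ((1 - z)\<^sup>2 * (1 - z)\<^sup>2)) (at z)"
      using ne[OF z] by (auto intro!: derivative_eq_intros simp: algebra_simps)
    also have "(1 * (1 - z)\<^sup>2 + 2 * (1 - z) * z) / ((1 - z)\<^sup>2 * (1 - z)\<^sup>2) = (1 + z) / (1 - z)^3"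
      using ne[OF z] by (simp add: divide_simps power2_eq_square power3_eq_cube) algebra
    finally show "((\<lambda>z. z * deriv ?f z) has_field_derivative (1 + z) / (1 - z)^3) (at z)"
      by (rule has_field_derivative_transform_within_open[OF _ open_ball z]) (simp add: d1)
  qed
  show q: "starlike_quotient ?f z = 1 / (1 - z)" if "z \<in> ball 0 1" for z
    using that ne[OF that] d1[OF that]
    by (auto simp: starlike_quotient_def divide_simps power2_eq_square)
  have sq: "starlike_quotient (\<lambda>z. z * deriv ?f z) z = (1 + z) / (1 - z)"
    if z: "z \<in> ball 0 1" for z
    using ne[OF z]
    by (cases "z = 0")
       (simp_all add: starlike_quotient_def d1[OF z] d2[OF z] power2_eq_square power3_eq_cube)
  have holo: "?f holomorphic_on ball 0 1"
    using ne by (intro holomorphic_intros) auto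
  have f: "?f \<in> normalized_analytic"
    using holo d1[of 0] by (simp add: normalized_analytic_def)
  have g: "(\<lambda>z. z * deriv ?f z) \<in> normalized_analytic"
    using holo d2[of 0] by (auto simp: normalized_analytic_def intro!: holomorphic_intros)
  have "(\<lambda>z. (1 + z) / (1 - z)) holomorphic_on ball (0 :: complex) 1"
    using ne by (intro holomorphic_intros) auto
  then have sh: "starlike_quotient (\<lambda>z. z * deriv ?f z) holomorphic_on ball 0 1"
    using sq by (subst holomorphic_cong[OF refl]) auto
  \<comment> \<open>The real part equals
    \<open>(1 - (norm z)\<^sup>2) / (norm (1 - z))\<^sup>2\<close>.\<close>
  have "Re ((1 + z) / (1 - z)) > 0" if z: "z \<in> ball 0 1" for z :: complex
  proof -
    have "(Re z)\<^sup>2 + (Im z)\<^sup>2 < 1"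
      using z by (simp flip: cmod_power2 add: power_less_one_iff)
    moreover have "(Re (1 - z))\<^sup>2 + (Im (1 - z))\<^sup>2 > 0"
      using ne[OF z] by (metis cmod_power2 zero_less_norm_iff zero_less_power)
    ultimately show ?thesis
      by (simp add: Re_divide power2_eq_square algebra_simps)
  qed
  with f g sh sq show "?f \<in> convex_class"
    by (simp add: convex_class_def starlike_class_def)
qed

section \<open>The Booth lemniscate\<close>

text \<open>Subtracting 1 and inverting turns \<open>1 / (1 - \<zeta>)\<close> into
  \<open>1 / \<zeta> - 1\<close> and the Booth map at \<open>z\<close> into
  \<open>1 / z - \<alpha> * z\<close>. Then \<open>Z = 1 / z\<close> exchanges the punctured disk
  with the exterior of the unit circle.\<close>

lemma half_plane_map_in_booth_iff:
  fixes \<alpha> :: real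
  assumes "0 \<le> \<alpha>" "\<alpha> < 1" "\<zeta> \<noteq> 0" "norm \<zeta> < 1"
  shows "1 / (1 - \<zeta>) \<in> booth_map \<alpha> ` ball 0 1 \<longleftrightarrow>
    (\<exists>Z. norm Z > 1 \<and> Z - of_real \<alpha> / Z = 1 / \<zeta> - 1)"
proof
  have ne: "1 - \<zeta> \<noteq> 0" using assms by auto
  have den: "1 - of_real \<alpha> * z\<^sup>2 \<noteq> 0" if "norm z < 1" for z :: complex
  proof
    assume "1 - of_real \<alpha> * z\<^sup>2 = 0"
    then have "norm (of_real \<alpha> * z\<^sup>2) = 1" by (metis eq_iff_diff_eq_0 norm_one)
    then have "\<alpha> * (norm z)\<^sup>2 = 1" using assms by (simp add: norm_mult norm_power)
    moreover have "\<alpha> * (norm z)\<^sup>2 \<le> \<alpha> * 1"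
      using assms that by (intro mult_left_mono) (auto simp: power_le_one)
    ultimately show False using assms by simp
  qed
  {
    assume "1 / (1 - \<zeta>) \<in> booth_map \<alpha> ` ball 0 1"
    then obtain z where z: "norm z < 1" "1 / (1 - \<zeta>) = 1 + z / (1 - of_real \<alpha> * z\<^sup>2)"
      by (auto simp: booth_map_def)
    have z0: "z \<noteq> 0" using z(2) ne assms by (auto simp: divide_simps)
    have "\<zeta> * (1 - of_real \<alpha> * z\<^sup>2) = z * (1 - \<zeta>)"
      using z(2) ne den[OF z(1)] by (simp add: divide_simps) algebra
    then have "1 / z - of_real \<alpha> / (1 / z) = 1 / \<zeta> - 1"
      using z0 assms by (simp add: field_simps power2_eq_square)
    moreover have "norm (1 / z) > 1" using z(1) z0 by (simp add: norm_divide)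
    ultimately show "\<exists>Z. norm Z > 1 \<and> Z - of_real \<alpha> / Z = 1 / \<zeta> - 1" by blast
  }
  {
    assume "\<exists>Z. norm Z > 1 \<and> Z - of_real \<alpha> / Z = 1 / \<zeta> - 1"
    then obtain Z where Z: "norm Z > 1" "Z - of_real \<alpha> / Z = 1 / \<zeta> - 1" by blast
    have Z0: "Z \<noteq> 0" using Z(1) by auto
    have nz: "norm (1 / Z) < 1" using Z(1) by (simp add: norm_divide divide_simps)
    have "Z\<^sup>2 * \<zeta> - of_real \<alpha> * \<zeta> = Z * (1 - \<zeta>)"
      using Z(2) Z0 assms by (simp add: field_simps power2_eq_square)
    then have "1 / (1 - \<zeta>) = 1 + (1 / Z) / (1 - of_real \<alpha> * (1 / Z)\<^sup>2)"
      using den[OF nz] ne Z0 by (simp add: divide_simps) algebra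
    then show "1 / (1 - \<zeta>) \<in> booth_map \<alpha> ` ball 0 1"
      using nz by (intro image_eqI[of _ _ "1 / Z"]) (simp_all add: booth_map_def)
  }
qed

text \<open>The equation is the quadratic \<open>Z\<^sup>2 - v * Z - \<alpha> = 0\<close>, whose
  roots have product \<open>- \<alpha>\<close>, so the root of larger modulus works. The lower bound
  on its modulus later makes the semi-axis \<open>p - \<alpha> / p\<close> nonnegative.\<close>

lemma larger_root:
  fixes v :: complex and \<alpha> :: real
  assumes "0 \<le> \<alpha>" "v \<noteq> 0"
  obtains Z where "Z \<noteq> 0" "\<alpha> \<le> (norm Z)\<^sup>2" "Z - of_real \<alpha> / Z = v"
proof -
  define s where "s = csqrt (v\<^sup>2 + 4 * of_real \<alpha>)"
  have s: "s\<^sup>2 = v\<^sup>2 + 4 * of_real \<alpha>" by (simp add: s_def)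
  have sum: "(v + s) / 2 + (v - s) / 2 = v" by (simp add: field_simps)
  have prod: "(v + s) / 2 * ((v - s) / 2) = - of_real \<alpha>"
    using s by (simp add: field_simps power2_eq_square)
  obtain Z Z' where Z: "Z + Z' = v" "Z * Z' = - of_real \<alpha>" "norm Z' \<le> norm Z"
    using sum prod by (metis add.commute mult.commute linear)
  have "Z \<noteq> 0" using Z(1,3) assms(2) by auto
  moreover have "\<alpha> = norm Z * norm Z'"
    using Z(2) assms(1) by (metis norm_minus_cancel norm_mult norm_of_real abs_of_nonneg)
  then have "\<alpha> \<le> (norm Z)\<^sup>2"
    using Z(3) by (simp add: power2_eq_square mult_left_mono)
  moreover have "of_real \<alpha> / Z = - Z'"
    using Z(2) \<open>Z \<noteq> 0\<close> by (simp add: field_simps)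
  then have "Z - of_real \<alpha> / Z = v"
    using Z(1) by simp
  ultimately show thesis using that by blast
qed

text \<open>In the next lemmas \<open>K\<close> is the largest distance from \<open>-1\<close> to the ellipse with semi-axes
  \<open>1 - \<alpha>\<close> and \<open>1 + \<alpha>\<close>, the image of the unit circle under \<open>Z \<mapsto> Z - \<alpha> / Z\<close>; the
  variable \<open>c\<close> is the cosine of the parameter.\<close>

lemma half_plane_map_in_booth:
  fixes \<alpha> K :: real
  assumes \<alpha>: "0 \<le> \<alpha>" "\<alpha> < 1" and K: "1 < K"
    and bound: "\<And>c. \<bar>c\<bar> \<le> 1 \<Longrightarrow> ((1 - \<alpha>) * c + 1)\<^sup>2 + (1 + \<alpha>)\<^sup>2 * (1 - c\<^sup>2) \<le> K\<^sup>2"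
    and \<zeta>: "norm \<zeta> < 1 / K"
  shows "1 / (1 - \<zeta>) \<in> booth_map \<alpha> ` ball 0 1"
proof (cases "\<zeta> = 0")
  case True
  then show ?thesis by (force simp: booth_map_def)
next
  case False
  have "1 / K < 1" using K by simp
  with \<zeta> have "norm \<zeta> < 1" by (rule less_trans)
  then have "1 / \<zeta> - 1 \<noteq> 0" using False by (auto simp: divide_simps)
  then obtain Z where Z: "Z \<noteq> 0" "\<alpha> \<le> (norm Z)\<^sup>2" "Z - of_real \<alpha> / Z = 1 / \<zeta> - 1"
    using larger_root \<alpha> by metis
  define p where "p = norm Z"
  have p: "p > 0" "\<alpha> \<le> p\<^sup>2" using Z by (auto simp: p_def)
  have "norm Z > 1"
  \<comment> \<open>If \<open>p \<le> 1\<close>, the point \<open>1 / \<zeta> - 1\<close> lies on an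
    ellipse with semi-axes \<open>p - \<alpha> / p\<close> and \<open>p + \<alpha> / p\<close>.
    These do not exceed \<open>1 - \<alpha>\<close> and \<open>1 + \<alpha>\<close>, so its distance
    from -1 is at most \<open>K\<close>, contradicting the bound on \<open>\<zeta>\<close>.\<close>
  proof (rule ccontr)
    assume "\<not> ?thesis"
    then have p1: "p \<le> 1" by (simp add: p_def)
    define c s where "c = Re Z / p" and "s = Im Z / p"
    have xy: "(Re Z)\<^sup>2 + (Im Z)\<^sup>2 = p\<^sup>2" by (simp add: p_def cmod_power2)
    have cs: "c\<^sup>2 + s\<^sup>2 = 1"
      using p xy by (simp add: c_def s_def power_divide flip: add_divide_distrib)
    have Zeq: "Re Z = p * c" "Im Z = p * s" using p by (auto simp: c_def s_def)
    have "p\<^sup>2 \<le> p" using p p1 by (simp add: power2_eq_square mult_left_le)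
    then have "\<alpha> \<le> p" using p(2) by linarith
    have a: "0 \<le> p - \<alpha> / p" "p - \<alpha> / p \<le> 1 - \<alpha>"
    proof -
      show "0 \<le> p - \<alpha> / p" using p by (simp add: field_simps power2_eq_square)
      have "\<alpha> \<le> \<alpha> / p" using p p1 \<alpha> by (simp add: field_simps mult_left_le)
      then show "p - \<alpha> / p \<le> 1 - \<alpha>" using p1 by simp
    qed
    have b: "0 \<le> p + \<alpha> / p" "p + \<alpha> / p \<le> 1 + \<alpha>"
    proof -
      show "0 \<le> p + \<alpha> / p" using p \<alpha> by simp
      have "(1 - p) * (p - \<alpha>) \<ge> 0" using p1 \<open>\<alpha> \<le> p\<close> by simp
      then show "p + \<alpha> / p \<le> 1 + \<alpha>" using p by (simp add: field_simps power2_eq_square)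
    qed
    have "\<bar>c\<bar> \<le> 1" using cs zero_le_power2[of s] by (subst abs_square_le_1[symmetric]) linarith
    have "of_real \<alpha> / Z = Complex (\<alpha> / p * c) (- \<alpha> / p * s)"
      using p unfolding complex_eq_iff Re_divide Im_divide xy by (simp add: Zeq power2_eq_square)
    then have "Z - of_real \<alpha> / Z = Complex ((p - \<alpha> / p) * c) ((p + \<alpha> / p) * s)"
      by (simp add: complex_eq_iff Zeq algebra_simps)
    then have "1 / \<zeta> = Complex ((p - \<alpha> / p) * c + 1) ((p + \<alpha> / p) * s)"
      using Z(3) by (simp add: complex_eq_iff)
    then have "(norm (1 / \<zeta>))\<^sup>2 = ((p - \<alpha> / p) * c + 1)\<^sup>2 + ((p + \<alpha> / p) * s)\<^sup>2"
      by (simp add: cmod_power2)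
    \<comment> \<open>Passing to \<open>\<bar>c\<bar>\<close> reflects the point into the right
      half-plane, away from -1; there the distance grows with each semi-axis.\<close>
    also have "\<dots> \<le> ((1 - \<alpha>) * \<bar>c\<bar> + 1)\<^sup>2 + ((1 + \<alpha>) * \<bar>s\<bar>)\<^sup>2"
    proof (intro add_mono)
      have "\<bar>(p - \<alpha> / p) * c\<bar> \<le> (1 - \<alpha>) * \<bar>c\<bar>"
        using a by (simp add: abs_mult mult_right_mono)
      then show "((p - \<alpha> / p) * c + 1)\<^sup>2 \<le> ((1 - \<alpha>) * \<bar>c\<bar> + 1)\<^sup>2"
        using \<alpha> by (intro power2_le_iff_abs_le[THEN iffD2]) auto
      show "((p + \<alpha> / p) * s)\<^sup>2 \<le> ((1 + \<alpha>) * \<bar>s\<bar>)\<^sup>2"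
        using b \<alpha> by (intro power2_le_iff_abs_le[THEN iffD2]) (auto simp: abs_mult mult_right_mono)
    qed
    also have "\<dots> = ((1 - \<alpha>) * \<bar>c\<bar> + 1)\<^sup>2 + (1 + \<alpha>)\<^sup>2 * (1 - \<bar>c\<bar>\<^sup>2)"
      using cs by (simp add: power_mult_distrib flip: cs)
    also have "\<dots> \<le> K\<^sup>2" using bound[of "\<bar>c\<bar>"] \<open>\<bar>c\<bar> \<le> 1\<close> by simp
    finally have "norm (1 / \<zeta>) \<le> K" using K by (simp add: power2_le_iff_abs_le)
    then show False using \<zeta> False K by (simp add: norm_divide field_simps)
  qed
  with Z(3) show ?thesis
    using half_plane_map_in_booth_iff[OF \<alpha> False \<open>norm \<zeta> < 1\<close>] by blast
qed

text \<open>The parameter \<open>c\<close> yields a point \<open>e\<close> of the unit circle whose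
  image on the ellipse has distance exactly \<open>K\<close> from -1. The solutions \<open>Z\<close>
  for that image are \<open>e\<close> and \<open>- \<alpha> / e\<close>, of modulus 1 and
  \<open>\<alpha>\<close>, so none lies outside the unit circle.\<close>

lemma half_plane_map_not_in_booth:
  fixes \<alpha> K c :: real
  assumes \<alpha>: "0 \<le> \<alpha>" "\<alpha> < 1" and K: "1 < K" and c: "\<bar>c\<bar> \<le> 1"
    and eq: "((1 - \<alpha>) * c + 1)\<^sup>2 + (1 + \<alpha>)\<^sup>2 * (1 - c\<^sup>2) = K\<^sup>2"
  obtains \<zeta> where "norm \<zeta> = 1 / K" "1 / (1 - \<zeta>) \<notin> booth_map \<alpha> ` ball 0 1"
proof -
  define s where "s = sqrt (1 - c\<^sup>2)"
  have s: "s\<^sup>2 = 1 - c\<^sup>2" using c by (simp add: s_def abs_square_le_1)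
  define e where "e = Complex c s"
  have ne: "norm e = 1" using s by (simp add: e_def cmod_def)
  then have e0: "e \<noteq> 0" by auto
  have "e * cnj e = 1" using complex_norm_square[of e] ne by simp
  then have "1 / e = cnj e" using e0 by (simp add: field_simps)
  then have ev: "e - of_real \<alpha> / e = Complex ((1 - \<alpha>) * c) ((1 + \<alpha>) * s)"
    using e0 by (simp add: e_def divide_inverse complex_eq_iff algebra_simps)
  define V where "V = 1 + (e - of_real \<alpha> / e)"
  have "(norm V)\<^sup>2 = K\<^sup>2"
    unfolding V_def ev using eq s by (simp add: cmod_power2 power_mult_distrib add.commute)
  then have nV: "norm V = K" using K by (simp add: power2_eq_iff_nonneg)
  then have V0: "V \<noteq> 0" using K by auto
  have "1 / (1 - 1 / V) \<notin> booth_map \<alpha> ` ball 0 1"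
  proof
    assume "1 / (1 - 1 / V) \<in> booth_map \<alpha> ` ball 0 1"
    then obtain Z where Z: "norm Z > 1" "Z - of_real \<alpha> / Z = 1 / (1 / V) - 1"
      using half_plane_map_in_booth_iff[OF \<alpha>, of "1 / V"] nV K V0 by (auto simp: norm_divide)
    have Z0: "Z \<noteq> 0" using Z(1) by auto
    have "Z - of_real \<alpha> / Z = e - of_real \<alpha> / e" using Z(2) by (simp add: V_def)
    then have "(Z - e) * (Z * e + of_real \<alpha>) = 0"
      using Z0 e0 by (simp add: field_simps power2_eq_square)
    then have "Z = e \<or> Z * e = - of_real \<alpha>" by (auto simp: add_eq_0_iff2)
    then have "norm Z = 1 \<or> norm Z = \<alpha>"
      using ne \<alpha> by (metis abs_of_nonneg mult.right_neutral norm_minus_cancel norm_mult norm_of_real)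
    then show False using Z(1) \<alpha> by auto
  qed
  moreover have "norm (1 / V) = 1 / K" using nV by (simp add: norm_divide)
  ultimately show thesis using that by blast
qed

section \<open>From the ellipse to the radius\<close>

text \<open>Every radius below \<open>1 / K\<close> is admissible for every convex function, since
  its quotient is \<open>1 / (1 - w z)\<close> with \<open>norm (w z) \<le> norm z\<close>. The
  function \<open>z / (1 - z)\<close> admits none beyond \<open>1 / K\<close>, so it attains the
  infimum.\<close>

lemma booth_starlikeness_radius_convex_class:
  fixes \<alpha> K c :: real
  assumes \<alpha>: "0 \<le> \<alpha>" "\<alpha> < 1" and K: "1 < K"
    and bound: "\<And>c. \<bar>c\<bar> \<le> 1 \<Longrightarrow> ((1 - \<alpha>) * c + 1)\<^sup>2 + (1 + \<alpha>)\<^sup>2 * (1 - c\<^sup>2) \<le> K\<^sup>2"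
    and c: "\<bar>c\<bar> \<le> 1"
    and eq: "((1 - \<alpha>) * c + 1)\<^sup>2 + (1 + \<alpha>)\<^sup>2 * (1 - c\<^sup>2) = K\<^sup>2"
  shows "booth_starlikeness_radius \<alpha> convex_class = 1 / K"
proof -
  define A where "A = (\<lambda>f. {r \<in> {0<..<1}. starlike_quotient f analytic_on cball 0 r \<and>
     (\<forall>z \<in> cball 0 r. starlike_quotient f z \<in> booth_map \<alpha> ` ball 0 1)})"
  have rad: "booth_radius_fun \<alpha> f = Sup (A f)" for f
    by (simp add: A_def booth_radius_fun_def)
  have K1: "0 < 1 / K" "1 / K < 1" using K by auto
  have sub: "{0<..<1 / K} \<subseteq> A f" if "f \<in> convex_class" for f
  proof
    fix r assume r: "r \<in> {0<..<1 / K}"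
    then have r1: "r < 1" using K1(2) by (auto intro: less_trans)
    obtain w where w: "\<And>z. z \<in> ball 0 1 \<Longrightarrow> norm (w z) \<le> norm z"
      "\<And>z. z \<in> ball 0 1 \<Longrightarrow> starlike_quotient f z = 1 / (1 - w z)"
      "starlike_quotient f holomorphic_on ball 0 1"
      using convex_class_starlike_quotient[OF \<open>f \<in> convex_class\<close>] by blast
    have "starlike_quotient f analytic_on ball 0 1"
      using w(3) by (simp add: analytic_on_open)
    then have "starlike_quotient f analytic_on cball 0 r"
      using r1 by (elim analytic_on_subset) auto
    moreover have "starlike_quotient f z \<in> booth_map \<alpha> ` ball 0 1" if "z \<in> cball 0 r" for z
      using w(1,2)[of z] that r r1 half_plane_map_in_booth[OF \<alpha> K bound, of "w z"] by auto
    ultimately show "r \<in> A f" using r r1 by (auto simp: A_def)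
  qed
  have ge: "1 / K \<le> Sup (A f)" if "f \<in> convex_class" for f
  proof -
    have "bdd_above (A f)" by (auto simp: A_def intro!: bdd_aboveI[of _ 1])
    then have "Sup {0<..<1 / K} \<le> Sup (A f)"
      using sub[OF that] K1 by (intro cSup_subset_mono) auto
    then show ?thesis using K1 by simp
  qed
  let ?f = "\<lambda>z :: complex. z / (1 - z)"
  have "A ?f \<subseteq> {..1 / K}"
  proof
    fix r assume r: "r \<in> A ?f"
    obtain \<zeta> where \<zeta>: "norm \<zeta> = 1 / K" "1 / (1 - \<zeta>) \<notin> booth_map \<alpha> ` ball 0 1"
      using half_plane_map_not_in_booth[OF \<alpha> K c eq] by blast
    then have "starlike_quotient ?f \<zeta> \<notin> booth_map \<alpha> ` ball 0 1"
      using starlike_quotient_half_plane_map[of \<zeta>] K1 by simp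
    then have "\<zeta> \<notin> cball 0 r" using r by (auto simp: A_def)
    then show "r \<in> {..1 / K}" using \<zeta>(1) by simp
  qed
  \<comment> \<open>Bounding a real supremum from above needs a nonempty set; \<open>sub\<close>
    supplies an element.\<close>
  then have "Sup (A ?f) \<le> 1 / K"
    using sub[OF half_plane_map_convex_class] K1 by (intro cSup_least) (auto dest: dense)
  with ge[OF half_plane_map_convex_class] have "Sup (A ?f) = 1 / K" by simp
  then have "Inf ((\<lambda>f. Sup (A f)) ` convex_class) = 1 / K"
    using ge half_plane_map_convex_class by (intro cInf_eq_minimum) force+
  then show ?thesis by (simp add: booth_starlikeness_radius_def rad)
qed

theorem corollary3p4:
  fixes \<alpha> :: real
  assumes "0 \<le> \<alpha>" and "\<alpha> < 1"
  shows "(\<alpha> \<le> 1/5 \<longrightarrow>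
            booth_starlikeness_radius \<alpha> convex_class = 1 / (2 - \<alpha>)) \<and>
         (1/5 \<le> \<alpha> \<longrightarrow>
            booth_starlikeness_radius \<alpha> convex_class =
              2 * sqrt \<alpha> / ((1 + \<alpha>) * sqrt (1 + 4 * \<alpha>)))"
proof (intro conjI impI)
  assume small: "\<alpha> \<le> 1/5"
  show "booth_starlikeness_radius \<alpha> convex_class = 1 / (2 - \<alpha>)"
  proof (rule booth_starlikeness_radius_convex_class[where c = 1])
    fix c :: real assume c: "\<bar>c\<bar> \<le> 1"
    \<comment> \<open>The gap to the value at the vertex \<open>c = 1\<close> factors as below; its
      second factor is at least \<open>2 - 10 * \<alpha>\<close>, which is where the threshold 1/5
      arises.\<close>
    have "\<alpha> * (1 + c) \<le> \<alpha> * 2" using c assms by (intro mult_left_mono) auto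
    then have "0 \<le> (1 - c) * (2 * (1 - \<alpha>) - 4 * (\<alpha> * (1 + c)))"
      using c small by (intro mult_nonneg_nonneg) auto
    also have "\<dots> = (2 - \<alpha>)\<^sup>2 - (((1 - \<alpha>) * c + 1)\<^sup>2 + (1 + \<alpha>)\<^sup>2 * (1 - c\<^sup>2))"
      by (simp add: power2_eq_square algebra_simps)
    finally show "((1 - \<alpha>) * c + 1)\<^sup>2 + (1 + \<alpha>)\<^sup>2 * (1 - c\<^sup>2) \<le> (2 - \<alpha>)\<^sup>2" by simp
  qed (use assms in \<open>auto simp: power2_eq_square algebra_simps\<close>)
next
  assume large: "1/5 \<le> \<alpha>"
  then have pos: "\<alpha> > 0" by simp
  define K where "K = (1 + \<alpha>) * sqrt (1 + 4 * \<alpha>) / (2 * sqrt \<alpha>)"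
  \<comment> \<open>The squared distance is a concave quadratic in \<open>c\<close> with its maximum
    \<open>K\<^sup>2\<close> at \<open>c0\<close>; \<open>id\<close> completes the square. Here
    \<open>c0 \<le> 1\<close> holds exactly when \<open>1/5 \<le> \<alpha>\<close>.\<close>
  define c0 where "c0 = (1 - \<alpha>) / (4 * \<alpha>)"
  have K2: "K\<^sup>2 = (1 + \<alpha>)\<^sup>2 * (1 + 4 * \<alpha>) / (4 * \<alpha>)"
    using pos by (simp add: K_def power_mult_distrib power_divide)
  have id: "((1 - \<alpha>) * c + 1)\<^sup>2 + (1 + \<alpha>)\<^sup>2 * (1 - c\<^sup>2) = K\<^sup>2 - 4 * \<alpha> * (c - c0)\<^sup>2" for c
    using pos unfolding K2 c0_def by (simp add: field_simps power2_eq_square)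
  \<comment> \<open>\<open>K\<close> exceeds 1 because its square is at least the squared distance
    \<open>(2 - \<alpha>)\<^sup>2\<close> to the vertex \<open>c = 1\<close>.\<close>
  have "1 < (2 - \<alpha>)\<^sup>2" using assms by (simp add: one_less_power)
  also have "\<dots> \<le> K\<^sup>2"
  proof -
    have "(2 - \<alpha>)\<^sup>2 = K\<^sup>2 - 4 * \<alpha> * (1 - c0)\<^sup>2" using id[of 1] by (simp add: algebra_simps)
    then show ?thesis using pos by simp
  qed
  finally have "1 < K"
    using assms by (intro power2_less_imp_less[of 1 K]) (simp_all add: K_def)
  then have "booth_starlikeness_radius \<alpha> convex_class = 1 / K"
  proof (rule booth_starlikeness_radius_convex_class[OF assms, where c = c0])
    show "((1 - \<alpha>) * c + 1)\<^sup>2 + (1 + \<alpha>)\<^sup>2 * (1 - c\<^sup>2) \<le> K\<^sup>2" for c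
      using pos by (simp add: id)
    show "\<bar>c0\<bar> \<le> 1" using large assms by (simp add: c0_def)
  qed (simp add: id)
  then show "booth_starlikeness_radius \<alpha> convex_class =
      2 * sqrt \<alpha> / ((1 + \<alpha>) * sqrt (1 + 4 * \<alpha>))"
    by (simp add: K_def)
qed

end
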